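(* Let $q$ be a prime power. Assume that $n$, $k$ and $\ell$ are three nonnegative integers with $\ell\leq k\leq 2n$ and $k=2k_0+\ell$ for a nonnegative integer $k_0$. Then $$|{\rm SHull}[2n,k]_q^{\ell}|=\left(\prod_{i=1}^{\ell} \frac{q^{2n-2k_0-2i+2}-1}{q^{2k_0+i}-q^{2k_0}}\right) q^{2k_0(n-k_0)}\begin{bmatrix} n \\ k_0 \end{bmatrix}_{q^2}.$$
   Context: A linear $[m,k]_q$ code is a $k$-dimensional subspace of $\mathbb{F}_q^m$. On $\mathbb{F}_q^{2n}$ the symplectic inner product is $\langle \mathbf{x},\mathbf{y}\rangle_{\rm s}=\sum_{i=1}^n(x_iy_{n+i}-x_{n+i}y_i)$. For a code $C\subseteq\mathbb{F}_q^{2n}$, $C^{\perp_{\rm s}}=\{\mathbf{y}\in\mathbb{F}_q^{2n} : \langle\mathbf{x},\mathbf{y}\rangle_{\rm s}=0\text{ for all }\mathbf{x}\in C\}$, and its symplectic hull is ${\rm Hull_s}(C)=C\cap C^{\perp_{\rm s}}$. ${\rm SHull}[2n,k]_q^{\ell}$ denotes the set of all linear $[2n,k]_q$ codes whose symplectic hull has dimension $\ell$ (distinct subspaces are counted as distinct codes). The Gaussian binomial coefficient is $\begin{bmatrix} n\\k\end{bmatrix}_Q=\frac{(Q^n-1)(Q^n-Q)\cdots(Q^n-Q^{k-1})}{(Q^k-1)(Q^k-Q)\cdots(Q^k-Q^{k-1})}$ for $k\ne0$ and $\begin{bmatrix} n\\0\end{bmatrix}_Q=1$, taken here with $Q=q^2$.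 Empty products equal $1$. *)

theory Defs
  imports Complex_Main "HOL-Library.Function_Algebras" "HOL-Library.Cardinality" "HOL-Number_Theory.Prime_Powers"
begin

text \<open>
  The field with \<open>q\<close> elements is a type \<open>'a :: {finite, field}\<close> with \<open>CARD('a) = q\<close>.
  Since the length \<open>m\<close> of a code is a variable (and may be \<open>0\<close>), the space of row vectors
  of length \<open>m\<close> is represented inside \<open>nat \<Rightarrow> 'a\<close>: coordinates are \<open>0, \<dots>, m - 1\<close>, and all
  later entries are \<open>0\<close>.
\<close>

definition vscale :: "'a::field \<Rightarrow> (nat \<Rightarrow> 'a) \<Rightarrow> nat \<Rightarrow> 'a" where
  "vscale c x = (\<lambda>i. c * x i)"

global_interpretation code: vector_space "vscale :: 'a::field \<Rightarrow> (nat \<Rightarrow> 'a) \<Rightarrow> nat \<Rightarrow> 'a"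
  by unfold_locales (simp_all add: vscale_def fun_eq_iff algebra_simps)

definition coord_space :: "nat \<Rightarrow> (nat \<Rightarrow> 'a::field) set" where
  "coord_space m = {x. \<forall>i\<ge>m. x i = 0}"

definition linear_code :: "nat \<Rightarrow> nat \<Rightarrow> (nat \<Rightarrow> 'a::field) set \<Rightarrow> bool" where
  "linear_code m k C \<longleftrightarrow> C \<subseteq> coord_space m \<and> code.subspace C \<and> code.dim C = k"

definition symp_form :: "nat \<Rightarrow> (nat \<Rightarrow> 'a::field) \<Rightarrow> (nat \<Rightarrow> 'a) \<Rightarrow> 'a" where
  "symp_form n x y = (\<Sum>i<n. x i * y (n + i) - x (n + i) * y i)"

definition symp_dual :: "nat \<Rightarrow> (nat \<Rightarrow> 'a::field) set \<Rightarrow> (nat \<Rightarrow> 'a) set" where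
  "symp_dual n C = {y \<in> coord_space (2 * n). \<forall>x\<in>C. symp_form n x y = 0}"

definition symp_hull :: "nat \<Rightarrow> (nat \<Rightarrow> 'a::field) set \<Rightarrow> (nat \<Rightarrow> 'a) set" where
  "symp_hull n C = C \<inter> symp_dual n C"

text \<open>The parameters \<open>n k l\<close> stand for codes of length \<open>2 * n\<close>, dimension \<open>k\<close> and hull
  dimension \<open>l\<close>.\<close>

definition SHull :: "nat \<Rightarrow> nat \<Rightarrow> nat \<Rightarrow> (nat \<Rightarrow> 'a::field) set set" where
  "SHull n k l = {C. linear_code (2 * n) k C \<and> code.dim (symp_hull n C) = l}"

definition gauss_binomial :: "nat \<Rightarrow> nat \<Rightarrow> real \<Rightarrow> real" where
  "gauss_binomial n k Q = (\<Prod>i<k. Q ^ n - Q ^ i) / (\<Prod>i<k. Q ^ k - Q ^ i)"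

end

theory Submission
  imports Defs
begin

text \<open>
  Double counting. Count the pairs consisting of a linearly independent list \<open>rs\<close> of \<open>l\<close> pairwise
  orthogonal vectors and a list \<open>hs\<close> of \<open>k0\<close> mutually orthogonal hyperbolic pairs in the orthogonal
  complement of \<open>rs\<close>. Together they span a code of dimension \<open>2 * k0 + l\<close> whose hull is spanned by
  \<open>rs\<close>, so every code with these parameters arises from as many pairs as its hull has ordered
  bases times the number of hyperbolic lists it contains. All these numbers are found by choosing
  the vectors one at a time: the count of hyperbolic lists in a space depends only on the sizes of
  the space and of its radical, so it serves both for the complement of \<open>rs\<close> and for a code.
\<close>

section \<open>Alternating forms over a finite field\<close>

text \<open>Alternation rather than skew-symmetry is the right axiom in characteristic 2 as well.
  The type \<open>'b\<close> may be infinite, as it is for coordinate vectors, so finiteness is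
  imposed on each subspace. In the comments below, q stands for \<open>CARD('a)\<close>.\<close>

locale alternating_form = vector_space scale
  for scale :: "'a::{finite,field} \<Rightarrow> 'b::ab_group_add \<Rightarrow> 'b" (infixr \<open>*s\<close> 75) +
  fixes form :: "'b \<Rightarrow> 'b \<Rightarrow> 'a"
  assumes form_add_left: "form (x + y) z = form x z + form y z"
    and form_add_right: "form z (x + y) = form z x + form z y"
    and form_scale_right: "form x (c *s y) = c * form x y"
    and form_self [simp]: "form x x = 0"
begin

lemma card_field_gt_1: "1 < CARD('a)"
proof -
  have "card {0, 1 :: 'a} \<le> CARD('a)" by (rule card_mono) auto
  then show ?thesis by simp
qed

lemma form_skew: "form x y = - form y x"
proof -
  have "form (x + y) (x + y) = form x x + form x y + (form y x + form y y)"
    by (simp only: form_add_left form_add_right ac_simps)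
  then show ?thesis by (simp add: eq_neg_iff_add_eq_0)
qed

lemma form_eq_0_sym: "form x y = 0 \<longleftrightarrow> form y x = 0"
  by (metis form_skew neg_equal_0_iff_equal)

lemma form_scale_left: "form (c *s x) y = c * form x y"
  using form_scale_right[of y c x] by (simp add: form_skew[of _ y])

lemma form_0_right [simp]: "form x 0 = 0"
  using form_scale_right[of x 0 0] by simp

lemma form_0_left [simp]: "form 0 x = 0"
  using form_eq_0_sym[of 0 x] by simp

lemma form_diff_left: "form (x - y) z = form x z - form y z"
  using form_add_left[of "x - y" y z] by simp

lemma form_diff_right: "form z (x - y) = form z x - form z y"
  using form_add_right[of z "x - y" y] by simp

definition radical :: "'b set \<Rightarrow> 'b set" where
  "radical V = {x \<in> V. \<forall>y\<in>V. form x y = 0}"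

definition perp :: "'b \<Rightarrow> 'b set \<Rightarrow> 'b set" where
  "perp r V = {x \<in> V. form r x = 0}"

lemma perp_subset: "perp r V \<subseteq> V"
  by (auto simp: perp_def)

lemma finite_perp: "finite V \<Longrightarrow> finite (perp r V)"
  by (simp add: perp_def)

lemma subspace_perp:
  assumes "subspace V"
  shows "subspace (perp r V)"
  by (rule subspaceI)
    (use assms in \<open>auto simp: perp_def form_add_right form_scale_right
       subspace_0 subspace_add subspace_scale\<close>)

lemma subspace_radical:
  assumes "subspace V"
  shows "subspace (radical V)"
  by (rule subspaceI)
    (use assms in \<open>auto simp: radical_def form_add_left form_scale_left
       subspace_0 subspace_add subspace_scale\<close>)

lemma form_span_eq_0:
  assumes "\<And>y. y \<in> A \<Longrightarrow> form x y = 0" and "y \<in> span A"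
  shows "form x y = 0"
  using assms(2)
  by (induction rule: span_induct_alt) (auto simp: form_add_right form_scale_right assms(1))

section \<open>Sizes of spans and of subspaces\<close>

lemma span_insert_subspace:
  assumes "subspace S"
  shows "span (insert r S) = (\<lambda>(c, s). s + c *s r) ` (UNIV \<times> S)"
proof -
  have "x \<in> span (insert r S) \<longleftrightarrow> (\<exists>c. x - c *s r \<in> S)" for x
    using span_breakdown_eq[of x r S] assms by (simp add: span_eq_iff[THEN iffD2])
  moreover have "(\<exists>c. x - c *s r \<in> S) \<longleftrightarrow> x \<in> (\<lambda>(c, s). s + c *s r) ` (UNIV \<times> S)" for x
  proof
    assume "\<exists>c. x - c *s r \<in> S"
    then obtain c where "x - c *s r \<in> S" ..
    moreover have "x = (\<lambda>(c, s). s + c *s r) (c, x - c *s r)" by simp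
    ultimately show "x \<in> (\<lambda>(c, s). s + c *s r) ` (UNIV \<times> S)" by blast
  next
    assume "x \<in> (\<lambda>(c, s). s + c *s r) ` (UNIV \<times> S)"
    then obtain c s where "s \<in> S" "x = s + c *s r" by auto
    then have "x - c *s r \<in> S" by simp
    then show "\<exists>c. x - c *s r \<in> S" ..
  qed
  ultimately show ?thesis by blast
qed

lemma span_Un_span_left: "span (span A \<union> B) = span (A \<union> B)"
  by (simp only: span_Un span_span)

lemma span_insert_span: "span (insert a (span A)) = span (insert a A)"
  using span_Un_span_left[of A "{a}"] by simp

lemma finite_span_insert:
  assumes "subspace S" and "finite S"
  shows "finite (span (insert r S))"
  using assms by (simp add: span_insert_subspace)

text \<open>Each element of the span is \<open>s + c *s r\<close> for exactly one pair
  \<open>(c, s)\<close>: two representations with different \<open>c\<close> would put a nonzero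
  multiple of \<open>r\<close>, hence \<open>r\<close> itself, into \<open>S\<close>.\<close>

lemma card_span_insert:
  assumes S: "subspace S" and "finite S" and r: "r \<notin> S"
  shows "card (span (insert r S)) = CARD('a) * card S"
proof -
  have "inj_on (\<lambda>(c, s). s + c *s r) (UNIV \<times> S)"
  proof (rule inj_onI, clarify)
    fix c d s t
    assume st: "s \<in> S" "t \<in> S" and eq: "s + c *s r = t + d *s r"
    then have *: "(c - d) *s r = t - s" by (simp add: scale_left_diff_distrib algebra_simps)
    then have "(c - d) *s r \<in> S" using S st by (simp add: subspace_diff)
    then have "inverse (c - d) *s (c - d) *s r \<in> S" using S subspace_scale by blast
    then have "c = d" using r by (cases "c = d") auto
    then show "c = d \<and> s = t" using eq by simp
  qed
  then show ?thesis by (simp add: span_insert_subspace[OF S] card_image card_cartesian_product)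
qed

lemma finite_span:
  assumes "finite A"
  shows "finite (span A)"
  using assms
proof (induction A)
  case (insert a A)
  then show ?case
    using finite_span_insert[OF subspace_span, of A a] by (simp add: span_insert_span)
qed simp

lemma card_span_independent:
  assumes "finite A" and "independent A"
  shows "card (span A) = CARD('a) ^ card A"
  using assms
proof (induction A)
  case (insert a A)
  have "a \<notin> span A" "independent A"
    using insert by (auto simp: independent_insert)
  then show ?case
    using insert card_span_insert[OF subspace_span finite_span, of A a]
    by (simp add: span_insert_span)
qed simp

lemma card_subspace:
  assumes "subspace V" and "finite V"
  shows "card V = CARD('a) ^ dim V"
proof -
  obtain A where A: "A \<subseteq> V" "independent A" "V \<subseteq> span A" "card A = dim V"
    using basis_exists by blast
  have "span A = V" using A assms by (metis span_eq_iff span_mono subset_antisym)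
  then show ?thesis using A card_span_independent[of A] assms(2) finite_subset by metis
qed

text \<open>The counting works with cardinalities; this links them to the dimensions by which codes
  and hulls are described.\<close>

lemma dim_eq_iff_card:
  assumes "subspace V" and "finite V"
  shows "dim V = d \<longleftrightarrow> card V = CARD('a) ^ d"
  using card_subspace[OF assms] card_field_gt_1 by simp

section \<open>Kernels of the functionals given by the form\<close>

text \<open>For \<open>e\<close> outside the radical, \<open>form e\<close> is a nonzero functional
  on \<open>V\<close>. Its level sets are translates of its kernel, which has index q.\<close>

lemma card_level_set:
  assumes V: "subspace V" "finite V" and e: "e \<in> V - radical V"
  shows "CARD('a) * card {f \<in> V. form e f = c} = card V"
proof -
  obtain w where w: "w \<in> V" "form e w \<noteq> 0" using e by (auto simp: radical_def)
  \<comment> \<open>Rescaled so that \<open>form e v = 1\<close>: then \<open>v\<close> and the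
    kernel span \<open>V\<close>, and translation by \<open>c *s v\<close> carries the kernel to the
    level set of \<open>c\<close>.\<close>
  define v where "v = inverse (form e w) *s w"
  have v: "v \<in> V" "form e v = 1"
    using w V by (auto simp: v_def form_scale_right subspace_scale)
  let ?K = "perp e V"
  have "span (insert v ?K) = V"
  proof
    show "span (insert v ?K) \<subseteq> V"
      using V v perp_subset by (intro span_minimal) auto
    show "V \<subseteq> span (insert v ?K)"
    proof
      fix x assume x: "x \<in> V"
      have "x - form e x *s v \<in> ?K"
        using x v V by (auto simp: perp_def form_diff_right form_scale_right
          subspace_diff subspace_scale)
      then have "x - form e x *s v \<in> span ?K" by (rule span_base)
      then show "x \<in> span (insert v ?K)" using span_breakdown_eq by blast
    qed
  qed
  then have "card V = CARD('a) * card ?K"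
    using card_span_insert[OF subspace_perp[OF V(1)] finite_perp[OF V(2)], of v e] v
    by (simp add: perp_def)
  moreover have "{f \<in> V. form e f = c} = (\<lambda>x. x + c *s v) ` ?K"
  proof (intro equalityI subsetI)
    fix x assume "x \<in> {f \<in> V. form e f = c}"
    then have "x - c *s v \<in> ?K"
      using v V by (auto simp: perp_def form_diff_right form_scale_right
        subspace_diff subspace_scale)
    then show "x \<in> (\<lambda>x. x + c *s v) ` ?K" by (force simp: image_iff)
  next
    fix x assume "x \<in> (\<lambda>x. x + c *s v) ` ?K"
    then show "x \<in> {f \<in> V. form e f = c}"
      using v V by (auto simp: perp_def form_add_right form_scale_right
        subspace_add subspace_scale)
  qed
  moreover have "card ((\<lambda>x. x + c *s v) ` ?K) = card ?K"
    by (rule card_image) (simp add: inj_on_def)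
  ultimately show ?thesis by simp
qed

lemma card_perp:
  assumes "subspace V" "finite V" "r \<in> V - radical V"
  shows "real (card (perp r V)) = real (card V) / real CARD('a)"
proof -
  have "real CARD('a) * real (card (perp r V)) = real (card V)"
    using card_level_set[OF assms, of 0] by (metis of_nat_mult perp_def)
  then show ?thesis using card_field_gt_1 by (simp add: field_simps)
qed

text \<open>A functional on \<open>V\<close> that vanishes on the kernel of \<open>form r\<close> is a multiple of \<open>form r\<close>.\<close>

lemma radical_perp:
  assumes V: "subspace V" and r: "r \<in> V - radical V"
  shows "radical (perp r V) = span (insert r (radical V))"
proof
  show "span (insert r (radical V)) \<subseteq> radical (perp r V)"
  proof (rule span_minimal)
    show "subspace (radical (perp r V))" using V by (simp add: subspace_perp subspace_radical)
    show "insert r (radical V) \<subseteq> radical (perp r V)"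
      using r by (auto simp: radical_def perp_def form_eq_0_sym[of r])
  qed
next
  obtain w where w: "w \<in> V" "form r w \<noteq> 0" using r by (auto simp: radical_def)
  show "radical (perp r V) \<subseteq> span (insert r (radical V))"
  proof
    fix x assume x: "x \<in> radical (perp r V)"
    \<comment> \<open>This choice makes \<open>x - c *s r\<close> orthogonal to \<open>w\<close>. It
      is orthogonal to \<open>perp r V\<close> for any \<open>c\<close>, and \<open>w\<close>
      together with \<open>perp r V\<close> spans \<open>V\<close>.\<close>
    define c where "c = form x w / form r w"
    have "x - c *s r \<in> radical V"
      unfolding radical_def
    proof (intro CollectI conjI ballI)
      show "x - c *s r \<in> V"
        using x r V by (auto simp: radical_def perp_def subspace_diff subspace_scale)
      fix y assume y: "y \<in> V"
      have "y - (form r y / form r w) *s w \<in> perp r V"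
        using y w V by (auto simp: perp_def form_diff_right form_scale_right
          subspace_diff subspace_scale)
      then have "form x (y - (form r y / form r w) *s w) = 0"
        using x by (simp add: radical_def)
      then show "form (x - c *s r) y = 0"
        by (simp add: form_diff_left form_diff_right form_scale_left form_scale_right c_def)
    qed
    then have "x - c *s r \<in> span (radical V)" by (rule span_base)
    then show "x \<in> span (insert r (radical V))" using span_breakdown_eq by blast
  qed
qed

section \<open>Isotropic chains\<close>

text \<open>For \<open>S = radical V = {0}\<close> these are the linearly independent lists of pairwise orthogonal
  vectors, and if the form vanishes on \<open>V\<close> the lists that are independent modulo \<open>S\<close>.\<close>

fun isotropic_chain :: "'b set \<Rightarrow> 'b set \<Rightarrow> 'b list \<Rightarrow> bool" where
  "isotropic_chain V S [] \<longleftrightarrow> True"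
| "isotropic_chain V S (r # rs) \<longleftrightarrow>
     r \<in> V - S \<and> isotropic_chain (perp r V) (span (insert r S)) rs"

lemma isotropic_chain_subset: "isotropic_chain V S rs \<Longrightarrow> set rs \<subseteq> V"
  by (induction V S rs rule: isotropic_chain.induct) (use perp_subset in auto)

lemma finite_isotropic_chains:
  assumes "finite V"
  shows "finite {rs. length rs = l \<and> isotropic_chain V S rs}"
  by (rule finite_subset[OF _ finite_lists_length_eq[OF assms, of l]])
    (use isotropic_chain_subset in auto)

lemma isotropic_chains_Suc:
  "{rs. length rs = Suc l \<and> isotropic_chain V S rs} = (\<lambda>(r, rs). r # rs) `
     (SIGMA r:V - S. {rs. length rs = l \<and> isotropic_chain (perp r V) (span (insert r S)) rs})"
  by (auto simp: image_iff length_Suc_conv)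

text \<open>One step of choosing vectors in turn. It rests on the number \<open>N\<close> of
  continuations being the same for every first vector \<open>r\<close>.\<close>

lemma card_isotropic_chains_Suc:
  assumes "finite V" and "S \<subseteq> V"
    and "\<And>r. r \<in> V - S \<Longrightarrow>
      real (card {rs. length rs = l \<and> isotropic_chain (perp r V) (span (insert r S)) rs}) = N"
  shows "real (card {rs. length rs = Suc l \<and> isotropic_chain V S rs})
    = (real (card V) - real (card S)) * N"
proof -
  have "real (card {rs. length rs = Suc l \<and> isotropic_chain V S rs}) = 
    real (\<Sum>r\<in>V - S. card {rs. length rs = l \<and> isotropic_chain (perp r V) (span (insert r S)) rs})"
    unfolding isotropic_chains_Suc
    using assms(1) by (subst card_image)
      (auto simp: inj_on_def card_SigmaI finite_isotropic_chains finite_perp)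
  also have "\<dots> = real (card (V - S)) * N"
    using assms(3) by simp
  finally show ?thesis
    using assms(1,2) by (simp add: card_Diff_subset card_mono finite_subset of_nat_diff)
qed

text \<open>By \<open>radical_perp\<close> the excluded set is again the radical after each choice.
  The space shrinks by a factor q while the radical grows by a factor q, which gives the factor for
  the vector chosen after \<open>i\<close> others. Once the space equals its radical, the factor is
  0 and no further choice exists.\<close>

lemma card_isotropic_chains_radical:
  assumes "subspace V" "finite V"
  shows "real (card {rs. length rs = l \<and> isotropic_chain V (radical V) rs})
    = (\<Prod>i<l. real (card V) / real CARD('a) ^ i - real (card (radical V)) * real CARD('a) ^ i)"
  using assms
proof (induction l arbitrary: V)
  case 0
  have "{rs. length rs = 0 \<and> isotropic_chain V (radical V) rs} = {[]}" by auto
  then show ?case by simp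
next
  case (Suc l)
  have sub: "radical V \<subseteq> V" by (auto simp: radical_def)
  have "real (card {rs. length rs = l \<and> isotropic_chain (perp r V) (span (insert r (radical V))) rs})
      = (\<Prod>i<l. real (card V) / real CARD('a) ^ Suc i - real (card (radical V)) * real CARD('a) ^ Suc i)"
    if r: "r \<in> V - radical V" for r
  proof -
    have c: "card (span (insert r (radical V))) = CARD('a) * card (radical V)"
      using r Suc.prems sub by (intro card_span_insert) (auto simp: subspace_radical finite_subset)
    show ?thesis
      using Suc.IH[of "perp r V"] Suc.prems r
      by (simp add: radical_perp c card_perp subspace_perp finite_perp ac_simps)
  qed
  from card_isotropic_chains_Suc[OF Suc.prems(2) sub this]
  show ?case by (simp add: prod.lessThan_Suc_shift del: prod.lessThan_Suc)
qed

lemma perp_totally_isotropic: "radical V = V \<Longrightarrow> r \<in> V \<Longrightarrow> perp r V = V"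
  by (auto simp: radical_def perp_def)

text \<open>Here \<open>perp r V = V\<close>, so only the excluded span grows, by a factor q per
  choice. For \<open>S = {0}\<close> this counts lists of independent vectors, and so the ordered
  bases of a hull.\<close>

lemma card_isotropic_chains_totally_isotropic:
  assumes "finite V" "subspace S" "S \<subseteq> V" "subspace V" "radical V = V"
  shows "real (card {rs. length rs = l \<and> isotropic_chain V S rs})
    = (\<Prod>i<l. real (card V) - real (card S) * real CARD('a) ^ i)"
  using assms
proof (induction l arbitrary: S)
  case 0
  have "{rs. length rs = 0 \<and> isotropic_chain V S rs} = {[]}" by auto
  then show ?case by simp
next
  case (Suc l)
  have "real (card {rs. length rs = l \<and> isotropic_chain (perp r V) (span (insert r S)) rs})
      = (\<Prod>i<l. real (card V) - real (card S) * real CARD('a) ^ Suc i)"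
    if r: "r \<in> V - S" for r
  proof -
    have c: "card (span (insert r S)) = CARD('a) * card S"
      using r Suc.prems by (intro card_span_insert) (auto simp: finite_subset)
    have "span (insert r S) \<subseteq> V" using r Suc.prems by (intro span_minimal) auto
    then show ?thesis
      using Suc.IH[of "span (insert r S)"] Suc.prems r
      by (simp add: c perp_totally_isotropic ac_simps)
  qed
  from card_isotropic_chains_Suc[OF Suc.prems(1,3) this]
  show ?case by (simp add: prod.lessThan_Suc_shift del: prod.lessThan_Suc)
qed

text \<open>Orthogonality to vectors of \<open>R\<close> is no restriction inside \<open>R\<close>,
  and the excluded spans agree on both sides. This compares bases of a hull with chains in the
  ambient space.\<close>

lemma isotropic_chain_totally_isotropic_iff:
  assumes "radical R = R" and "R \<subseteq> V"
  shows "isotropic_chain R S rs \<longleftrightarrow> isotropic_chain V S rs \<and> set rs \<subseteq> R"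
  using assms(2)
proof (induction rs arbitrary: V S)
  case (Cons r rs)
  show ?case
  proof (cases "r \<in> R")
    case True
    \<comment> \<open>The induction thus shrinks \<open>V\<close> while \<open>R\<close> stays fixed
      below it.\<close>
    have "R \<subseteq> perp r V" using Cons.prems True assms(1) by (auto simp: radical_def perp_def)
    then show ?thesis
      using Cons.IH[of "perp r V"] Cons.prems True perp_totally_isotropic[OF assms(1) True] by auto
  qed auto
qed simp

definition orthogonal :: "'b list \<Rightarrow> 'b set \<Rightarrow> 'b set" where
  "orthogonal rs V = {x \<in> V. \<forall>r\<in>set rs. form r x = 0}"

lemma orthogonal_Cons: "orthogonal (r # rs) V = orthogonal rs (perp r V)"
  by (auto simp: orthogonal_def perp_def)

lemma subspace_orthogonal: "subspace V \<Longrightarrow> subspace (orthogonal rs V)"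
  by (induction rs arbitrary: V) (simp_all add: orthogonal_Cons subspace_perp, simp add: orthogonal_def)

text \<open>Iterates \<open>radical_perp\<close> and \<open>card_perp\<close>. For nondegenerate
  \<open>V\<close> the chain spans the radical of its own orthogonal complement, in which the
  hyperbolic pairs are then chosen.\<close>

lemma orthogonal_isotropic_chain:
  assumes "subspace V" "finite V" "isotropic_chain V (radical V) rs"
  shows "radical (orthogonal rs V) = span (radical V \<union> set rs)"
    and "real (card (orthogonal rs V)) = real (card V) / real CARD('a) ^ length rs"
    and "card (span (radical V \<union> set rs)) = card (radical V) * CARD('a) ^ length rs"
proof -
  have "radical (orthogonal rs V) = span (radical V \<union> set rs) \<and>
    real (card (orthogonal rs V)) = real (card V) / real CARD('a) ^ length rs \<and>
    card (span (radical V \<union> set rs)) = card (radical V) * CARD('a) ^ length rs"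
    using assms
  proof (induction rs arbitrary: V)
    case Nil
    then show ?case
      using subspace_radical[of V] by (simp add: orthogonal_def span_eq_iff[THEN iffD2])
  next
    case (Cons r rs)
    have r: "r \<in> V - radical V" using Cons.prems by simp
    have rad: "radical (perp r V) = span (insert r (radical V))"
      using radical_perp Cons.prems r by simp
    have sub: "radical V \<subseteq> V" by (auto simp: radical_def)
    have c: "card (span (insert r (radical V))) = CARD('a) * card (radical V)"
      using r Cons.prems sub by (intro card_span_insert) (auto simp: subspace_radical finite_subset)
    have sp: "span (span (insert r (radical V)) \<union> set rs) = span (radical V \<union> set (r # rs))"
      by (simp add: span_Un_span_left)
    show ?case
      using Cons.IH[of "perp r V"] Cons.prems r
      by (simp add: orthogonal_Cons rad sp[simplified] c card_perp subspace_perp finite_perp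
          mult.commute mult.left_commute)
  qed
  then show "radical (orthogonal rs V) = span (radical V \<union> set rs)"
    and "real (card (orthogonal rs V)) = real (card V) / real CARD('a) ^ length rs"
    and "card (span (radical V \<union> set rs)) = card (radical V) * CARD('a) ^ length rs" by auto
qed

section \<open>Hyperbolic lists\<close>

text \<open>These lists are symplectic bases of nondegenerate subspaces. Independence is built in:
  \<open>form e f = 1\<close> makes each pair span a nondegenerate plane, and later pairs are
  orthogonal to it.\<close>

fun hyperbolic :: "'b set \<Rightarrow> ('b \<times> 'b) list \<Rightarrow> bool" where
  "hyperbolic V [] \<longleftrightarrow> True"
| "hyperbolic V ((e, f) # hs) \<longleftrightarrow>
     e \<in> V \<and> f \<in> V \<and> form e f = 1 \<and> hyperbolic (perp f (perp e V)) hs"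

definition vectors :: "('b \<times> 'b) list \<Rightarrow> 'b set" where
  "vectors hs = fst ` set hs \<union> snd ` set hs"

lemma vectors_simps [simp]:
  "vectors [] = {}"
  "vectors ((e, f) # hs) = insert e (insert f (vectors hs))"
  by (auto simp: vectors_def)

lemma hyperbolic_subset: "hyperbolic V hs \<Longrightarrow> vectors hs \<subseteq> V"
  by (induction V hs rule: hyperbolic.induct) (auto simp: perp_def)

text \<open>Apart from membership, the conditions involve only form values among the listed vectors.
  Hence one list can be read inside a code or inside the complement of a chain.\<close>

lemma hyperbolic_restrict_iff:
  assumes "A \<subseteq> V"
  shows "hyperbolic A hs \<longleftrightarrow> hyperbolic V hs \<and> vectors hs \<subseteq> A"
  using assms
proof (induction hs arbitrary: A V)
  case (Cons h hs)
  obtain e f where h: "h = (e, f)" by (cases h)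
  have eq: "perp f (perp e A) = A \<inter> perp f (perp e V)"
    using Cons.prems by (auto simp: perp_def)
  have "hyperbolic (perp f (perp e A)) hs \<longleftrightarrow>
      hyperbolic (perp f (perp e V)) hs \<and> vectors hs \<subseteq> A"
    using Cons.IH[of "perp f (perp e A)" "perp f (perp e V)"]
      hyperbolic_subset[of "perp f (perp e V)" hs] eq by blast
  then show ?case using Cons.prems by (auto simp: h)
qed simp

lemma finite_hyperbolics:
  assumes "finite V"
  shows "finite {hs. length hs = k \<and> hyperbolic V hs}"
proof (rule finite_subset)
  show "{hs. length hs = k \<and> hyperbolic V hs} \<subseteq> {hs. set hs \<subseteq> V \<times> V \<and> length hs = k}"
    using hyperbolic_subset by (fastforce simp: vectors_def image_subset_iff)
  show "finite {hs. set hs \<subseteq> V \<times> V \<and> length hs = k}"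
    using assms by (intro finite_lists_length_eq) simp
qed

text \<open>A vector \<open>e\<close> with \<open>form e f = 1\<close> for some \<open>f\<close> in
  \<open>V\<close> is outside the radical; recording this makes \<open>card_level_set\<close>
  applicable to the choice of \<open>f\<close>.\<close>

lemma hyperbolics_Suc:
  "{hs. length hs = Suc k \<and> hyperbolic V hs} = (\<lambda>(h, hs). h # hs) `
     (SIGMA h:(SIGMA e:V - radical V. {f \<in> V. form e f = 1}).
        {hs. length hs = k \<and> hyperbolic (perp (snd h) (perp (fst h) V)) hs})"
  by (fastforce simp: image_iff length_Suc_conv radical_def)

text \<open>\<open>V\<close> is the orthogonal sum of the plane spanned by \<open>e\<close> and
  \<open>f\<close> and of its complement, and a nondegenerate plane contributes nothing to the
  radical.\<close>

lemma radical_hyperbolic_complement: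
  assumes "subspace V" "e \<in> V" "f \<in> V" "form e f = 1"
  shows "radical (perp f (perp e V)) = radical V"
proof
  have fe: "form f e = -1" using form_skew[of f e] assms(4) by simp
  show "radical V \<subseteq> radical (perp f (perp e V))"
    using assms by (auto simp: radical_def perp_def form_eq_0_sym[of e] form_eq_0_sym[of f])
  show "radical (perp f (perp e V)) \<subseteq> radical V"
  proof
    fix x assume x: "x \<in> radical (perp f (perp e V))"
    have "form x y = 0" if y: "y \<in> V" for y
    proof -
      \<comment> \<open>The orthogonal projection of \<open>y\<close> to the complement of the
        plane; the signs come from \<open>form f e = -1\<close>.\<close>
      have "y + form f y *s e - form e y *s f \<in> perp f (perp e V)"
        using assms y fe by (auto simp: perp_def form_add_right form_diff_right form_scale_right
          subspace_diff subspace_add subspace_scale)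
      then have "form x (y + form f y *s e - form e y *s f) = 0" using x by (simp add: radical_def)
      moreover have "form x e = 0" "form x f = 0"
        using x form_eq_0_sym[of x] by (auto simp: radical_def perp_def)
      ultimately show ?thesis by (simp add: form_add_right form_diff_right form_scale_right)
    qed
    then show "x \<in> radical V" using x by (auto simp: radical_def perp_def)
  qed
qed

text \<open>Two steps of index q. The first is \<open>card_perp\<close> for \<open>e\<close>. As
  \<open>f\<close> lies outside \<open>perp e V\<close>, the second instead recovers
  \<open>perp e V\<close> from the complement by adjoining \<open>e\<close>.\<close>

lemma card_hyperbolic_complement:
  assumes "subspace V" "finite V" "e \<in> V" "f \<in> V" "form e f = 1"
  shows "real (card (perp f (perp e V))) = real (card V) / real CARD('a) ^ 2"
proof -
  have e: "e \<in> V - radical V" using assms by (force simp: radical_def)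
  have fe: "form f e = -1" using form_skew[of f e] assms(5) by simp
  have sp: "span (insert e (perp f (perp e V))) = perp e V"
  proof
    show "span (insert e (perp f (perp e V))) \<subseteq> perp e V"
      using assms by (intro span_minimal subspace_perp) (auto simp: perp_def)
    show "perp e V \<subseteq> span (insert e (perp f (perp e V)))"
    proof
      fix x assume x: "x \<in> perp e V"
      have "x - (- form f x) *s e \<in> perp f (perp e V)"
        using x assms fe by (auto simp: perp_def form_diff_right form_add_right form_scale_right
          subspace_diff subspace_add subspace_scale)
      then have "x - (- form f x) *s e \<in> span (perp f (perp e V))" by (rule span_base)
      then show "x \<in> span (insert e (perp f (perp e V)))" using span_breakdown_eq by blast
    qed
  qed
  have "card (span (insert e (perp f (perp e V)))) = CARD('a) * card (perp f (perp e V))"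
    using assms fe
    by (intro card_span_insert subspace_perp finite_perp) (auto simp: perp_def)
  then have "real (card (perp e V)) = real CARD('a) * real (card (perp f (perp e V)))"
    by (simp add: sp)
  then show ?thesis
    using card_perp[OF assms(1,2) e] card_field_gt_1 by (simp add: field_simps power2_eq_square)
qed

text \<open>After \<open>j\<close> pairs the space has shrunk by q^(2j) and its radical is
  unchanged. Then \<open>e\<close> is any vector outside the radical, and \<open>f\<close> ranges
  over a level set of \<open>form e\<close>, a fraction 1/q of the space.\<close>

lemma card_hyperbolics:
  assumes "subspace V" "finite V"
  shows "real (card {hs. length hs = k \<and> hyperbolic V hs}) =
    (\<Prod>j<k. (real (card V) / real CARD('a) ^ (2 * j) - real (card (radical V)))
             * (real (card V) / real CARD('a) ^ (2 * j + 1)))"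
  using assms
proof (induction k arbitrary: V)
  case 0
  have "{hs. length hs = 0 \<and> hyperbolic V hs} = {[]}" by auto
  then show ?case by simp
next
  case (Suc k)
  define pairs where "pairs = (SIGMA e:V - radical V. {f \<in> V. form e f = 1})"
  define N where "N = (\<Prod>j<k. (real (card V) / real CARD('a) ^ (2 * Suc j) - real (card (radical V)))
             * (real (card V) / real CARD('a) ^ (2 * Suc j + 1)))"
  have fin: "finite pairs" unfolding pairs_def using Suc.prems by auto
  have sub: "radical V \<subseteq> V" by (auto simp: radical_def)
  have N: "real (card {hs. length hs = k \<and> hyperbolic (perp (snd h) (perp (fst h) V)) hs}) = N"
    if h: "h \<in> pairs" for h
  proof -
    have ef: "fst h \<in> V" "snd h \<in> V" "form (fst h) (snd h) = 1"
      using h by (auto simp: pairs_def)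
    show ?thesis
      using Suc.IH[of "perp (snd h) (perp (fst h) V)"] Suc.prems ef
      by (simp add: N_def radical_hyperbolic_complement card_hyperbolic_complement subspace_perp
          finite_perp power2_eq_square mult.assoc)
  qed
  have "real (card {f \<in> V. form e f = 1}) = real (card V) / real CARD('a)" if "e \<in> V - radical V" for e
  proof -
    have "real CARD('a) * real (card {f \<in> V. form e f = 1}) = real (card V)"
      using card_level_set[OF Suc.prems that, of 1] by (metis of_nat_mult)
    then show ?thesis using card_field_gt_1 by (simp add: field_simps)
  qed
  then have pairs: "real (card pairs)
      = (real (card V) - real (card (radical V))) * (real (card V) / real CARD('a))"
    unfolding pairs_def using Suc.prems sub
    by (simp add: card_SigmaI card_Diff_subset card_mono finite_subset of_nat_diff)
  have "real (card {hs. length hs = Suc k \<and> hyperbolic V hs}) =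
    real (\<Sum>h\<in>pairs. card {hs. length hs = k \<and> hyperbolic (perp (snd h) (perp (fst h) V)) hs})"
    unfolding hyperbolics_Suc pairs_def[symmetric]
    using Suc.prems fin by (subst card_image)
      (auto simp: inj_on_def card_SigmaI finite_hyperbolics finite_perp)
  also have "\<dots> = real (card pairs) * N" using N by simp
  finally show ?case
    unfolding prod.lessThan_Suc_shift pairs N_def by simp
qed

text \<open>Each pair adds to \<open>S\<close> an orthogonal nondegenerate plane, so the size grows
  by q^2 and the radical stays. The induction absorbs the pair into \<open>S\<close> and shrinks
  \<open>A\<close> to the complement of the pair, which keeps the two orthogonal.\<close>

lemma span_hyperbolic:
  assumes "subspace S" "finite S" "hyperbolic A hs" "\<And>x y. x \<in> S \<Longrightarrow> y \<in> A \<Longrightarrow> form x y = 0"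
  shows "card (span (S \<union> vectors hs)) = card S * CARD('a) ^ (2 * length hs)"
    and "radical (span (S \<union> vectors hs)) = radical S"
proof -
  have "card (span (S \<union> vectors hs)) = card S * CARD('a) ^ (2 * length hs) \<and>
    radical (span (S \<union> vectors hs)) = radical S"
    using assms
  proof (induction hs arbitrary: S A)
    case Nil
    then show ?case by (simp add: span_eq_iff[THEN iffD2])
  next
    case (Cons h hs)
    obtain e f where h: "h = (e, f)" by (cases h)
    have ef: "e \<in> A" "f \<in> A" "form e f = 1" "hyperbolic (perp f (perp e A)) hs"
      using Cons.prems by (auto simp: h)
    have fe: "form f e = -1" using form_skew[of f e] ef by simp
    define S1 where "S1 = span (insert f S)"
    define S2 where "S2 = span (insert e S1)"
    have S1: "subspace S1" "finite S1" 
      using Cons.prems by (auto simp: S1_def finite_span_insert)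
    have S2: "subspace S2" "finite S2"
      using S1 by (auto simp: S2_def finite_span_insert)
    have S2_eq: "S2 = span (insert e (insert f S))"
      unfolding S2_def S1_def by (rule span_insert_span)
    have Se: "form x e = 0" "form x f = 0" if "x \<in> S" for x
      using Cons.prems(4) that ef by auto
    \<comment> \<open>All of \<open>S\<close> is orthogonal to \<open>e\<close>, but
      \<open>f\<close> is not. Likewise all of \<open>S1\<close> is orthogonal to \<open>f\<close>,
      but \<open>e\<close> is not.\<close>
    have f: "f \<notin> S" using Se(1)[of f] fe by auto
    have e: "e \<notin> S1"
    proof
      assume "e \<in> S1"
      then have "form f e = 0" unfolding S1_def
        by (rule form_span_eq_0[rotated]) (use Se form_eq_0_sym in auto)
      then show False using fe by simp
    qed
    have card: "card S2 = card S * CARD('a) ^ 2"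
      using card_span_insert[OF Cons.prems(1,2) f] card_span_insert[OF S1 e]
      by (simp add: S1_def S2_def power2_eq_square)
    have "S \<subseteq> S2" "e \<in> S2" "f \<in> S2" unfolding S2_eq by (auto intro: span_base)
    have "radical S2 = radical S"
    proof
      show "radical S \<subseteq> radical S2"
      proof
        fix x assume x: "x \<in> radical S"
        have "form x y = 0" if "y \<in> S2" for y
          using that unfolding S2_eq
          by (rule form_span_eq_0[rotated]) (use x Se in \<open>auto simp: radical_def\<close>)
        then show "x \<in> radical S2" using x \<open>S \<subseteq> S2\<close> by (auto simp: radical_def)
      qed
      show "radical S2 \<subseteq> radical S"
      proof
        fix x assume x: "x \<in> radical S2"
        then have "x \<in> S2" by (simp add: radical_def)
        \<comment> \<open>With \<open>x = s + d *s f + c *s e\<close>, pairing with \<open>e\<close>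
          yields \<open>- d\<close> and pairing with \<open>f\<close> yields \<open>c\<close>; both
          vanish for \<open>x\<close> in the radical.\<close>
        then obtain c s1 where 1: "s1 \<in> S1" "x = s1 + c *s e"
          unfolding S2_def span_insert_subspace[OF S1(1)] by auto
        then obtain d s where 2: "s \<in> S" "s1 = s + d *s f"
          unfolding S1_def span_insert_subspace[OF Cons.prems(1)] by auto
        have "form x e = 0" "form x f = 0" "\<And>y. y \<in> S \<Longrightarrow> form x y = 0"
          using x \<open>S \<subseteq> S2\<close> \<open>e \<in> S2\<close> \<open>f \<in> S2\<close> by (auto simp: radical_def)
        moreover have "c = 0" "d = 0"
          using calculation(1,2) Se[OF 2(1)] ef fe
          by (auto simp: 1 2 form_add_left form_scale_left)
        ultimately show "x \<in> radical S" using 1 2 by (auto simp: radical_def)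
      qed
    qed
    moreover have "form x y = 0" if "x \<in> S2" "y \<in> perp f (perp e A)" for x y
    proof -
      have "form y x = 0"
        using that(1) unfolding S2_eq
        by (rule form_span_eq_0[rotated])
          (use that(2) Cons.prems(4) in \<open>auto simp: perp_def form_eq_0_sym[of y]\<close>)
      then show ?thesis using form_eq_0_sym by simp
    qed
    moreover have "span (S2 \<union> vectors hs) = span (S \<union> vectors (h # hs))"
      unfolding S2_eq h by (simp add: span_Un_span_left)
    ultimately show ?case
      using Cons.IH[OF S2 ef(4)] by (simp add: card power_add power2_eq_square)
  qed
  then show "card (span (S \<union> vectors hs)) = card S * CARD('a) ^ (2 * length hs)"
    and "radical (span (S \<union> vectors hs)) = radical S" by auto
qed

section \<open>Counting subspaces with a given radical dimension\<close>

text \<open>The right side counts all pairs of a chain and a hyperbolic list in its complement, a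
  space of size \<open>card V\<close> / q^l with radical of size q^l. The factor beside
  \<open>card codes\<close> counts the pairs that yield one fixed code.\<close>

lemma card_subspaces_radical:
  fixes V :: "'b set" and k l :: nat
  assumes V: "subspace V" "finite V" and nondeg: "radical V = {0}"
  defines "codes \<equiv> {C. C \<subseteq> V \<and> subspace C \<and> card C = CARD('a) ^ (2 * k + l) \<and> card (radical C) = CARD('a) ^ l}"
  shows "real (card codes) *
      ((\<Prod>i<l. real CARD('a) ^ l - real CARD('a) ^ i) *
       (\<Prod>j<k. (real CARD('a) ^ (2 * k + l) / real CARD('a) ^ (2 * j) - real CARD('a) ^ l)
                * (real CARD('a) ^ (2 * k + l) / real CARD('a) ^ (2 * j + 1)))) =
    (\<Prod>i<l. real (card V) / real CARD('a) ^ i - real CARD('a) ^ i) *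
    (\<Prod>j<k. (real (card V) / real CARD('a) ^ l / real CARD('a) ^ (2 * j) - real CARD('a) ^ l)
                * (real (card V) / real CARD('a) ^ l / real CARD('a) ^ (2 * j + 1)))"
    (is "_ * ?D = ?R")
proof -
  define P where "P = (SIGMA rs:{rs. length rs = l \<and> isotropic_chain V {0} rs}.
      {hs. length hs = k \<and> hyperbolic (orthogonal rs V) hs})"
  define F where "F C = {rs. length rs = l \<and> isotropic_chain (radical C) {0} rs} \<times>
      {hs. length hs = k \<and> hyperbolic C hs}" for C
  \<comment> \<open>The inner \<open>span\<close> presents the isotropic part as a subspace, the
    shape in which \<open>span_hyperbolic\<close> takes it.\<close>
  define code_of where "code_of p = span (span (set (fst p)) \<union> vectors (snd p))"
    for p :: "'b list \<times> ('b \<times> 'b) list"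
  have fin_codes: "finite codes"
    by (rule finite_subset[of _ "Pow V"]) (use V in \<open>auto simp: codes_def\<close>)
  have span_rs: "span ({0} \<union> set rs) = span (set rs)" for rs
    by (simp add: span_insert_0)
  have rs_facts: "radical (orthogonal rs V) = span (set rs)"
    "real (card (orthogonal rs V)) = real (card V) / real CARD('a) ^ l"
    "card (span (set rs)) = CARD('a) ^ l"
    if "isotropic_chain V {0} rs" "length rs = l" for rs
    using orthogonal_isotropic_chain[OF V, of rs] that nondeg span_rs by auto
  have fin_orth: "finite (orthogonal rs V)" for rs
    using V by (auto simp: orthogonal_def)
  have isotropic: "radical (radical C) = radical C" for C
    by (auto simp: radical_def)
  have card_P: "real (card P) = ?R"
  proof -
    have "real (card P) = real (\<Sum>rs\<in>{rs. length rs = l \<and> isotropic_chain V {0} rs}.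
        card {hs. length hs = k \<and> hyperbolic (orthogonal rs V) hs})"
      unfolding P_def by (subst card_SigmaI)
        (auto simp: finite_isotropic_chains finite_hyperbolics V fin_orth)
    also have "\<dots> = real (card {rs. length rs = l \<and> isotropic_chain V {0} rs}) *
        (\<Prod>j<k. (real (card V) / real CARD('a) ^ l / real CARD('a) ^ (2 * j) - real CARD('a) ^ l)
                * (real (card V) / real CARD('a) ^ l / real CARD('a) ^ (2 * j + 1)))"
      by (simp add: card_hyperbolics subspace_orthogonal V fin_orth rs_facts)
    finally show ?thesis
      using card_isotropic_chains_radical[OF V, of l] by (simp add: nondeg)
  qed
  have code_facts: "card (code_of p) = CARD('a) ^ (2 * k + l)" "radical (code_of p) = span (set (fst p))"
    if p: "p \<in> P" for p
  proof -
    obtain rs hs where [simp]: "p = (rs, hs)" by (cases p)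
    have rs: "length rs = l" "isotropic_chain V {0} rs"
      and hs: "length hs = k" "hyperbolic (orthogonal rs V) hs"
      using p by (auto simp: P_def)
    have rad: "span (set rs) = radical (orthogonal rs V)" using rs_facts rs by simp
    have orth: "form x y = 0" if "x \<in> span (set rs)" "y \<in> orthogonal rs V" for x y
      using that unfolding rad by (auto simp: radical_def)
    \<comment> \<open>As the radical of the complement of \<open>rs\<close>,
      \<open>span (set rs)\<close> is orthogonal to all pairs in \<open>hs\<close> and is its own
      radical, so it becomes the radical of the code.\<close>
    note * = span_hyperbolic[OF subspace_span finite_span hs(2), of "set rs", OF _ orth, simplified]
    show "card (code_of p) = CARD('a) ^ (2 * k + l)"
      using * rs_facts rs hs by (simp add: code_of_def power_add)
    show "radical (code_of p) = span (set (fst p))"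
      using * rad isotropic by (simp add: code_of_def)
  qed
  have code_in: "code_of p \<in> codes" if p: "p \<in> P" for p
  proof -
    have "set (fst p) \<subseteq> V"
      using p isotropic_chain_subset[of V "{0}" "fst p"] by (auto simp: P_def)
    moreover have "vectors (snd p) \<subseteq> V"
      using p hyperbolic_subset[of "orthogonal (fst p) V" "snd p"]
      by (auto simp: P_def orthogonal_def)
    ultimately have "code_of p \<subseteq> V"
      unfolding code_of_def using V by (intro span_minimal Un_least) auto
    moreover have "card (span (set (fst p))) = CARD('a) ^ l"
      using p rs_facts by (auto simp: P_def)
    ultimately show ?thesis using code_facts[OF p] by (simp add: codes_def code_of_def)
  qed
  \<comment> \<open>The pairs yielding \<open>C\<close> are exactly the bases of its radical
    combined with the hyperbolic lists inside \<open>C\<close>, so the fibre is a full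
    product.\<close>
  have fibre: "{p \<in> P. code_of p = C} = F C" if C: "C \<in> codes" for C
  proof (intro equalityI subsetI)
    fix p assume p: "p \<in> {p \<in> P. code_of p = C}"
    obtain rs hs where [simp]: "p = (rs, hs)" by (cases p)
    have rs: "length rs = l" "isotropic_chain V {0} rs"
      and hs: "length hs = k" "hyperbolic (orthogonal rs V) hs"
      using p by (auto simp: P_def)
    have CV: "C \<subseteq> V" using C by (simp add: codes_def)
    have rad: "radical C = span (set rs)" using code_facts p by auto
    have "set rs \<subseteq> radical C" unfolding rad by (auto intro: span_base)
    moreover have "radical C \<subseteq> V" using CV by (auto simp: radical_def)
    ultimately have "isotropic_chain (radical C) {0} rs"
      using isotropic_chain_totally_isotropic_iff[OF isotropic] rs by blast
    moreover have "hyperbolic C hs"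
    proof -
      have "hyperbolic V hs"
        using hs(2) hyperbolic_restrict_iff[of "orthogonal rs V" V hs] by (auto simp: orthogonal_def)
      moreover have "vectors hs \<subseteq> C" using p by (auto simp: code_of_def intro: span_base)
      ultimately show ?thesis using hyperbolic_restrict_iff[OF CV] by blast
    qed
    ultimately show "p \<in> F C" using rs hs by (simp add: F_def)
  next
    fix p assume p: "p \<in> F C"
    obtain rs hs where [simp]: "p = (rs, hs)" by (cases p)
    have rs: "length rs = l" "isotropic_chain (radical C) {0} rs"
      and hs: "length hs = k" "hyperbolic C hs"
      using p by (auto simp: F_def)
    have C': "C \<subseteq> V" "subspace C" "card C = CARD('a) ^ (2 * k + l)" using C by (auto simp: codes_def)
    then have radV: "radical C \<subseteq> V" by (auto simp: radical_def)
    have rs_rad: "set rs \<subseteq> radical C" using isotropic_chain_subset rs by blast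
    have "isotropic_chain V {0} rs"
      using isotropic_chain_totally_isotropic_iff[OF isotropic radV] rs by blast
    moreover have "hyperbolic (orthogonal rs V) hs"
    proof -
      have "C \<subseteq> orthogonal rs V" using rs_rad C' by (auto simp: radical_def orthogonal_def)
      then show ?thesis
        using hyperbolic_restrict_iff[of C "orthogonal rs V" hs] hs by blast
    qed
    ultimately have pP: "p \<in> P" using rs hs by (simp add: P_def)
    have "span (set rs) \<subseteq> C"
      using rs_rad C' by (intro span_minimal) (auto simp: radical_def)
    then have "code_of p \<subseteq> C"
      unfolding code_of_def using hyperbolic_subset[OF hs(2)] C'
      by (intro span_minimal) auto
    \<comment> \<open>The inclusion is an equality because both sides have q^(2k+l)
      elements.\<close>
    then have "code_of p = C"
      using code_facts(1)[OF pP] C' V by (intro card_subset_eq) (auto intro: finite_subset)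
    then show "p \<in> {p \<in> P. code_of p = C}" using pP by simp
  qed
  have card_F: "real (card (F C)) = ?D" if C: "C \<in> codes" for C
  proof -
    have C': "C \<subseteq> V" "subspace C" "card C = CARD('a) ^ (2 * k + l)" "card (radical C) = CARD('a) ^ l"
      using C by (auto simp: codes_def)
    have fin: "finite C" using C' V finite_subset by blast
    have fin': "finite (radical C)" using fin by (simp add: radical_def)
    have "0 \<in> radical C" using C' by (simp add: subspace_0 subspace_radical)
    then have "real (card {rs. length rs = l \<and> isotropic_chain (radical C) {0} rs})
        = (\<Prod>i<l. real CARD('a) ^ l - real CARD('a) ^ i)"
      using card_isotropic_chains_totally_isotropic[of "radical C" "{0}" l] C' fin'
      by (simp add: isotropic subspace_radical)
    moreover have "real (card {hs. length hs = k \<and> hyperbolic C hs}) =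
      (\<Prod>j<k. (real CARD('a) ^ (2 * k + l) / real CARD('a) ^ (2 * j) - real CARD('a) ^ l)
                * (real CARD('a) ^ (2 * k + l) / real CARD('a) ^ (2 * j + 1)))"
      using card_hyperbolics[OF C'(2) fin, of k] C' by simp
    ultimately show ?thesis by (simp add: F_def card_cartesian_product)
  qed
  have "finite P"
    unfolding P_def using V fin_orth
    by (intro finite_SigmaI) (auto simp: finite_isotropic_chains finite_hyperbolics)
  then have "card P = (\<Sum>C\<in>codes. card {p \<in> P. code_of p = C})"
    using sum.group[of P codes code_of "\<lambda>_. 1::nat"] fin_codes code_in by (simp add: image_subset_iff)
  then have "real (card P) = (\<Sum>C\<in>codes. real (card (F C)))" by (simp add: fibre)
  also have "\<dots> = real (card codes) * ?D" by (simp add: card_F)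
  finally show ?thesis using card_P by simp
qed

end

section \<open>The symplectic form on coordinate vectors\<close>

lemma alternating_form_symp_form:
  "alternating_form (vscale :: 'a::{finite,field} \<Rightarrow> _) (symp_form n)"
proof unfold_locales
qed (simp_all add: symp_form_def vscale_def sum.distrib[symmetric] sum_distrib_left algebra_simps)

lemma coord_space_Suc:
  "coord_space (Suc m) = (\<lambda>(c, x). x(m := c)) ` (UNIV \<times> coord_space m)"
proof (intro equalityI subsetI)
  fix x :: "nat \<Rightarrow> 'a" assume "x \<in> coord_space (Suc m)"
  then have "(x(m := 0)) i = 0" if "m \<le> i" for i
    using that by (cases "i = m") (auto simp: coord_space_def)
  then have "x(m := 0) \<in> coord_space m" by (simp add: coord_space_def)
  moreover have "x = (x(m := 0))(m := x m)" by simp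
  ultimately show "x \<in> (\<lambda>(c, x). x(m := c)) ` (UNIV \<times> coord_space m)"
    by (intro image_eqI[where x = "(x m, x(m := 0))"]) auto
qed (auto simp: coord_space_def)

lemma card_coord_space:
  "finite (coord_space m :: (nat \<Rightarrow> 'a::{finite,field}) set)"
  "card (coord_space m :: (nat \<Rightarrow> 'a::{finite,field}) set) = CARD('a) ^ m"
proof (induction m)
  case 0
  have "coord_space 0 = {0 :: nat \<Rightarrow> 'a}" by (auto simp: coord_space_def fun_eq_iff)
  then show "finite (coord_space 0 :: (nat \<Rightarrow> 'a) set)"
    and "card (coord_space 0 :: (nat \<Rightarrow> 'a) set) = CARD('a) ^ 0" by simp_all
next
  case (Suc m)
  have "inj_on (\<lambda>(c, x). x(m := c)) (UNIV \<times> (coord_space m :: (nat \<Rightarrow> 'a) set))"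
  proof (rule inj_onI, clarify)
    fix c d :: 'a and x y :: "nat \<Rightarrow> 'a"
    assume *: "x \<in> coord_space m" "y \<in> coord_space m" "x(m := c) = y(m := d)"
    then have "x m = y m" by (simp add: coord_space_def)
    moreover have "x i = y i" if "i \<noteq> m" for i
      using fun_cong[OF *(3), of i] that by simp
    moreover have "c = d" using fun_cong[OF *(3), of m] by simp
    ultimately show "c = d \<and> x = y" by (metis ext)
  qed
  then show "card (coord_space (Suc m) :: (nat \<Rightarrow> 'a) set) = CARD('a) ^ Suc m"
    using Suc.IH by (simp add: coord_space_Suc card_image card_cartesian_product)
  show "finite (coord_space (Suc m) :: (nat \<Rightarrow> 'a) set)"
    using Suc.IH by (simp add: coord_space_Suc)
qed

lemma subspace_coord_space: "code.subspace (coord_space m)"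
  by (rule code.subspaceI) (simp_all add: coord_space_def vscale_def)

text \<open>Pairing with the unit vector at the partner coordinate, \<open>n + i\<close> for
  \<open>i\<close> and \<open>j\<close> for \<open>n + j\<close>, reads off each entry of
  \<open>x\<close> up to sign.\<close>

lemma symp_form_nondegenerate:
  assumes "x \<in> coord_space (2 * n)" and "\<And>y. y \<in> coord_space (2 * n) \<Longrightarrow> symp_form n x y = 0"
  shows "x = 0"
proof
  fix i
  consider "i < n" | j where "i = n + j" "j < n" | "2 * n \<le> i"
    by (metis add_diff_inverse_nat less_diff_conv2 linorder_not_less mult_2 nat_add_left_cancel_less)
  then show "x i = 0 i"
  proof cases
    case 1
    have "symp_form n x (\<lambda>t. if t = n + i then 1 else 0) = x i"
      using 1 by (simp add: symp_form_def if_distrib[of "(*) _"] cong: if_cong sum.cong_simp)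
    moreover have "(\<lambda>t. if t = n + i then 1 else 0) \<in> coord_space (2 * n)"
      using 1 by (auto simp: coord_space_def)
    ultimately show ?thesis using assms(2) by (metis zero_fun_apply)
  next
    case (2 j)
    have "symp_form n x (\<lambda>t. if t = j then 1 else 0) = - x i"
      using 2 by (simp add: symp_form_def sum_negf if_distrib[of "(*) _"] cong: if_cong sum.cong_simp)
    moreover have "(\<lambda>t. if t = j then 1 else 0) \<in> coord_space (2 * n)"
      using 2 by (auto simp: coord_space_def)
    ultimately show ?thesis using assms(2) by (metis neg_equal_0_iff_equal zero_fun_apply)
  next
    case 3
    then show ?thesis using assms(1) by (simp add: coord_space_def)
  qed
qed

section \<open>Evaluation of the quotient of the counts\<close>

text \<open>Every product splits into powers of \<open>x\<close> and factors \<open>Z t\<close> or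
  \<open>E t\<close>. The powers are compared at the end; the \<open>Z\<close> factors agree after
  regrouping.\<close>

lemma hull_count_quotient:
  fixes x N :: real
  assumes x: "1 < x" and k: "k \<le> n"
    and N: "N * ((\<Prod>i<l. x ^ l - x ^ i) *
       (\<Prod>j<k. (x ^ (2 * k + l) / x ^ (2 * j) - x ^ l) * (x ^ (2 * k + l) / x ^ (2 * j + 1)))) =
    (\<Prod>i<l. x ^ (2 * n) / x ^ i - x ^ i) *
    (\<Prod>j<k. (x ^ (2 * n) / x ^ l / x ^ (2 * j) - x ^ l) * (x ^ (2 * n) / x ^ l / x ^ (2 * j + 1)))"
  shows "N = (\<Prod>i = 1..l. (x powi (2 * int n - 2 * int k - 2 * int i + 2) - 1)
                  / (x ^ (2 * k + i) - x ^ (2 * k)))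
      * x powi (2 * int k * (int n - int k)) * gauss_binomial n k (x\<^sup>2)"
proof -
  \<comment> \<open>This is x^(2n-2t) - 1, written as a quotient so that it also makes sense for
    \<open>t > n\<close>. If \<open>k + l > n\<close>, the factor \<open>Z n = 0\<close> occurs in
    \<open>Z4\<close> and the count is 0.\<close>
  define Z where "Z t = x ^ (2 * n) / x ^ (2 * t) - 1" for t
  define E where "E t = x ^ t - 1" for t
  \<comment> \<open>\<open>a\<close> and \<open>c\<close> cancel between the two sides of the
    counting identity, \<open>g\<close> between numerator and denominator of the Gaussian
    binomial.\<close>
  define a where "a = (\<Prod>i<l. x ^ i)"
  define c where "c = (\<Prod>j<k. x ^ (2 * j + 1))"
  define g where "g = (\<Prod>j<k. x ^ (2 * j))"
  define Z1 where "Z1 = (\<Prod>i<l. Z i)"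
  define Z2 where "Z2 = (\<Prod>j<k. Z (l + j))"
  define Z3 where "Z3 = (\<Prod>i<k. Z i)"
  define Z4 where "Z4 = (\<Prod>i<l. Z (k + i))"
  define E1 where "E1 = (\<Prod>i<l. E (Suc i))"
  define E2 where "E2 = (\<Prod>j<k. E (2 * (k - j)))"
  have x0: "x \<noteq> 0" "x > 0" using x by auto
  have nz: "a \<noteq> 0" "c \<noteq> 0" "g \<noteq> 0" using x0 by (auto simp: a_def c_def g_def)
  have E_nz: "E t \<noteq> 0" if "t > 0" for t
    using one_less_power[OF x that] by (simp add: E_def)
  then have E12: "E1 \<noteq> 0" "E2 \<noteq> 0" by (auto simp: E1_def E2_def)
  \<comment> \<open>The product of the first \<open>k + l\<close> factors, split after
    \<open>l\<close> as the counting produces it, or after \<open>k\<close> as the claimed formula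
    has it.\<close>
  have ZZ: "Z1 * Z2 = Z3 * Z4"
  proof -
    have split: "(\<Prod>i<u + v. Z i) = (\<Prod>i<u. Z i) * (\<Prod>i<v. Z (u + i))" for u v
      by (induction v) simp_all
    show ?thesis
      using split[of l k] split[of k l] by (simp add: Z1_def Z2_def Z3_def Z4_def add.commute)
  qed
  have A1: "(\<Prod>i<l. x ^ (2 * n) / x ^ i - x ^ i) = a * Z1"
    unfolding a_def Z1_def prod.distrib[symmetric]
    by (rule prod.cong) (use x0 in \<open>auto simp: Z_def field_simps power_add[symmetric] mult_2\<close>)
  have A2: "(\<Prod>j<k. (x ^ (2 * n) / x ^ l / x ^ (2 * j) - x ^ l) *
      (x ^ (2 * n) / x ^ l / x ^ (2 * j + 1))) = (x ^ (2 * n)) ^ k * Z2 / c"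
  proof -
    have "(x ^ (2 * n) / x ^ l / x ^ (2 * j) - x ^ l) * (x ^ (2 * n) / x ^ l / x ^ (2 * j + 1))
      = x ^ (2 * n) * Z (l + j) / x ^ (2 * j + 1)" for j
      using x0 by (simp add: Z_def divide_simps) (simp add: algebra_simps power_add mult_2_right)
    then show ?thesis by (simp add: Z2_def c_def prod.distrib prod_dividef)
  qed
  have D1: "(\<Prod>i<l. x ^ l - x ^ i) = a * E1"
  proof -
    have "(\<Prod>i<l. x ^ l - x ^ i) = (\<Prod>i<l. x ^ i * E (l - i))"
      by (rule prod.cong) (auto simp: E_def algebra_simps power_add[symmetric])
    also have "\<dots> = a * (\<Prod>i<l. E (l - i))" by (simp add: a_def prod.distrib)
    also have "(\<Prod>i<l. E (l - i)) = E1"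
      unfolding E1_def using prod.nat_diff_reindex[of "\<lambda>i. E (Suc i)" l]
      by (metis (no_types, lifting) Suc_diff_Suc lessThan_iff prod.cong)
    finally show ?thesis .
  qed
  have D2: "(\<Prod>j<k. (x ^ (2 * k + l) / x ^ (2 * j) - x ^ l) * (x ^ (2 * k + l) / x ^ (2 * j + 1)))
      = (x ^ (2 * k + 2 * l)) ^ k * E2 / c"
  proof -
    have "(x ^ (2 * k + l) / x ^ (2 * j) - x ^ l) * (x ^ (2 * k + l) / x ^ (2 * j + 1))
      = x ^ (2 * k + 2 * l) * E (2 * (k - j)) / x ^ (2 * j + 1)" if "j < k" for j
    proof -
      have "x ^ (2 * k) = x ^ (2 * (k - j)) * x ^ (2 * j)"
        using that by (simp add: power_add[symmetric] add_mult_distrib2[symmetric] del: mult_Suc_right)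
      then show ?thesis
        using x0 by (simp add: E_def divide_simps) (simp add: algebra_simps power_add mult_2_right)
    qed
    then have "(\<Prod>j<k. (x ^ (2 * k + l) / x ^ (2 * j) - x ^ l) *
        (x ^ (2 * k + l) / x ^ (2 * j + 1)))
      = (\<Prod>j<k. x ^ (2 * k + 2 * l) * E (2 * (k - j)) / x ^ (2 * j + 1))"
      by (intro prod.cong) (simp_all only: lessThan_iff)
    then show ?thesis by (simp only: E2_def c_def prod.distrib prod_dividef prod_constant card_lessThan)
  qed
  have R1: "(\<Prod>i = 1..l. (x powi (2 * int n - 2 * int k - 2 * int i + 2) - 1)
                  / (x ^ (2 * k + i) - x ^ (2 * k))) = Z4 / ((x ^ (2 * k)) ^ l * E1)"
  proof -
    have "(\<Prod>i = 1..l. (x powi (2 * int n - 2 * int k - 2 * int i + 2) - 1)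
                  / (x ^ (2 * k + i) - x ^ (2 * k)))
      = (\<Prod>i<l. (x powi (2 * int n - 2 * int k - 2 * int (Suc i) + 2) - 1)
                  / (x ^ (2 * k + Suc i) - x ^ (2 * k)))"
      by (simp only: prod.atLeast1_atMost_eq One_nat_def)
    also have "\<dots> = (\<Prod>i<l. Z (k + i) / (x ^ (2 * k) * E (Suc i)))"
    proof (rule prod.cong)
      fix i
      \<comment> \<open>Reindexing from \<open>1..l\<close> to \<open>i < l\<close> absorbs the
        \<open>+ 2\<close> in the exponent.\<close>
      have "2 * int n - 2 * int k - 2 * int (Suc i) + 2 = int (2 * n) - int (2 * (k + i))" by simp
      then have "x powi (2 * int n - 2 * int k - 2 * int (Suc i) + 2) - 1 = Z (k + i)"
        by (simp only: power_int_diff[OF disjI1[OF x0(1)]] power_int_of_nat Z_def)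
      moreover have "x ^ (2 * k + Suc i) - x ^ (2 * k) = x ^ (2 * k) * E (Suc i)"
        by (simp add: E_def power_add algebra_simps)
      ultimately show "(x powi (2 * int n - 2 * int k - 2 * int (Suc i) + 2) - 1)
          / (x ^ (2 * k + Suc i) - x ^ (2 * k)) = Z (k + i) / (x ^ (2 * k) * E (Suc i))" by simp
    qed simp
    finally show ?thesis by (simp add: Z4_def E1_def prod.distrib prod_dividef)
  qed
  have R2: "gauss_binomial n k (x\<^sup>2) = Z3 / E2"
  proof -
    have "(\<Prod>i<k. (x\<^sup>2) ^ n - (x\<^sup>2) ^ i) = g * Z3"
      unfolding g_def Z3_def prod.distrib[symmetric]
      by (rule prod.cong) (use x0 in \<open>auto simp: Z_def field_simps power_mult[symmetric]\<close>)
    moreover have "(\<Prod>i<k. (x\<^sup>2) ^ k - (x\<^sup>2) ^ i) = g * E2"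
      unfolding g_def E2_def prod.distrib[symmetric]
      by (rule prod.cong)
        (auto simp: E_def algebra_simps power_mult[symmetric] power_add[symmetric])
    ultimately show ?thesis using nz by (simp add: gauss_binomial_def)
  qed
  have R3: "x powi (2 * int k * (int n - int k)) = x ^ (2 * k * (n - k))"
  proof -
    have "2 * int k * (int n - int k) = int (2 * k * (n - k))" using k by (simp add: of_nat_diff)
    then show ?thesis by (simp only: power_int_of_nat)
  qed
  \<comment> \<open>Both sides are x^(2k(n+l)); this is where the power of \<open>x\<close> in the
    claimed formula comes from.\<close>
  have pow: "(x ^ (2 * n)) ^ k * (x ^ (2 * k)) ^ l = x ^ (2 * k * (n - k)) * (x ^ (2 * k + 2 * l)) ^ k"
  proof -
    obtain m where "n = k + m" using k le_Suc_ex by blast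
    then show ?thesis by (simp add: power_mult[symmetric] power_add[symmetric] algebra_simps)
  qed
  define y where "y = (x ^ (2 * k + 2 * l)) ^ k"
  define w where "w = (x ^ (2 * k)) ^ l"
  have yw: "y \<noteq> 0" "w \<noteq> 0" using x0 by (auto simp: y_def w_def)
  have "N * (a * E1 * (y * E2 / c)) = a * Z1 * ((x ^ (2 * n)) ^ k * Z2 / c)"
    using N unfolding A1 A2 D1 D2 y_def .
  then have "N * E1 * y * E2 = Z1 * Z2 * (x ^ (2 * n)) ^ k"
    using nz by (simp add: field_simps)
  then have "N * E1 * E2 * w * y = Z3 * Z4 * ((x ^ (2 * n)) ^ k * w)"
    by (simp add: ZZ ac_simps)
  also have "\<dots> = Z3 * Z4 * x ^ (2 * k * (n - k)) * y"
    using pow by (simp add: y_def w_def)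
  finally have "N * E1 * E2 * w = Z3 * Z4 * x ^ (2 * k * (n - k))" using yw by simp
  then show ?thesis
    unfolding R1 R2 R3 w_def[symmetric] using E12 yw by (simp add: field_simps)
qed

theorem theorem4p9:
  fixes q n k l k0 :: nat
  assumes "primepow q"
    and "CARD('a) = q"
    and "l \<le> k" and "k \<le> 2 * n"
    and "k = 2 * k0 + l"
  shows "real (card (SHull n k l :: (nat \<Rightarrow> 'a::{finite, field}) set set)) =
    (\<Prod>i = 1..l. (real q powi (2 * int n - 2 * int k0 - 2 * int i + 2) - 1)
                  / (real q ^ (2 * k0 + i) - real q ^ (2 * k0)))
      * real q powi (2 * int k0 * (int n - int k0))
      * gauss_binomial n k0 ((real q)\<^sup>2)"
proof -
  interpret symp: alternating_form "vscale :: 'a \<Rightarrow> _" "symp_form n"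
    by (rule alternating_form_symp_form)
  let ?V = "coord_space (2 * n) :: (nat \<Rightarrow> 'a) set"
  \<comment> \<open>The dual puts the code vector first in the form, the radical puts it second;
    orthogonality is symmetric.\<close>
  have hull: "symp_hull n C = symp.radical C" if "C \<subseteq> ?V" for C
    using that symp.form_eq_0_sym by (auto simp: symp_hull_def symp_dual_def symp.radical_def)
  have "symp.radical ?V = {0}"
    using symp_form_nondegenerate code.subspace_0[OF subspace_coord_space]
    by (auto simp: symp.radical_def)
  note count = symp.card_subspaces_radical[OF subspace_coord_space card_coord_space(1) this]
  have "C \<in> SHull n k l \<longleftrightarrow> C \<subseteq> ?V \<and> code.subspace C \<and>
      card C = CARD('a) ^ (2 * k0 + l) \<and> card (symp.radical C) = CARD('a) ^ l" for C
  proof (cases "C \<subseteq> ?V \<and> code.subspace C")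
    case True
    then have "finite C" using card_coord_space(1) finite_subset by blast
    moreover from this have "finite (symp.radical C)" by (simp add: symp.radical_def)
    ultimately show ?thesis
      using True symp.dim_eq_iff_card[of C k] symp.dim_eq_iff_card[of "symp.radical C" l]
        symp.subspace_radical[of C] \<open>k = 2 * k0 + l\<close>
      by (simp add: SHull_def linear_code_def hull)
  qed (auto simp: SHull_def linear_code_def)
  then have "SHull n k l = {C. C \<subseteq> ?V \<and> code.subspace C \<and>
      card C = CARD('a) ^ (2 * k0 + l) \<and> card (symp.radical C) = CARD('a) ^ l}" by blast
  \<comment> \<open>The condition \<open>k0 \<le> n\<close> of the quotient lemma follows from
    \<open>2 * k0 + l \<le> 2 * n\<close>, and the ambient space has q^(2n) elements.\<close>
  then show ?thesis
    using hull_count_quotient[of "real CARD('a)" k0 n] count[of k0 l]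
      symp.card_field_gt_1 assms by (simp add: card_coord_space(2))
qed

end
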